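(* Let $\mathbb{F}_q$ be a finite field of characteristic $p$, let $f\in\mathbb{F}_q[x]$ be a nonzero monic polynomial, and let $D=\{f_1,f_2,\ldots,f_k\}$ (the $f_i$ distinct) be a set of monic divisors of $f$ with $f\notin D$. Then the eigenvalues of (the adjacency matrix of) the gcd-graph $G_f(D)$ are given by the set \[ \left\{\sum_{i=1}^k c\left(g,\frac{f}{f_i}\right)\right\}_{g\in\mathbb{F}_q[x]/(f)}. \] In particular, all eigenvalues of $G_f(D)$ are integers.
   Context: All polynomials $f,f_i$ are monic and gcd's are taken monic (so $\gcd(0,f)=f$). The gcd-graph $G_f(D)$ is the undirected loopless graph with vertex set the ring $\mathbb{F}_q[x]/(f)$ in which two vertices $u,v$ are adjacent if and only if $\gcd(u-v,f)\in D$. A non-degenerate linear functional on $\mathbb{F}_q[x]/(h)$ is an $\mathbb{F}_q$-linear map $\psi\colon\mathbb{F}_q[x]/(h)\to\mathbb{F}_q$ whose kernel contains no nonzero ideal (for example, the coefficient of $x^{\deg h-1}$ of the reduced representative). Fix a primitive $p$-th root of unity $\zeta_p\in\mathbb{C}$ and let $\mathrm{Tr}\colon\mathbb{F}_q\to\mathbb{F}_p$ be the trace. For a monic $h$ and a polynomial $g$ the Ramanujan sum is \[ c(g,h)=\sum_{a\in(\mathbb{F}_q[x]/(h))^\times}\zeta_p^{\mathrm{Tr}(\psi(ga))}, \] where $\psi$ is any non-degenerate linear functional on $\mathbb{F}_q[x]/(h)$; its value does not depend on the choice of $\psi$. For $h\mid f$, $c(g,h)$ depends only on the class of $g$ modulo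 $f$. *)

theory Defs
  imports
    "HOL-Library.Cardinality"
    "HOL-Computational_Algebra.Computational_Algebra"
    "HOL-Algebra.Ideal"
    "Graph_Theory.Pair_Digraph"
    "Jordan_Normal_Form.Spectral_Radius"
begin

text \<open>
  The ring \<open>F[x]/(h)\<close>, on canonical representatives (the style of \<open>residue_ring\<close> for the integers).
  For \<open>h = 1\<close> this is the zero ring, in which \<open>0\<close> is a unit.
\<close>

definition poly_residue_ring :: "'a::field poly \<Rightarrow> 'a poly ring" where
  "poly_residue_ring h =
     \<lparr>carrier = {u. u mod h = u},
      monoid.mult = \<lambda>u v. (u * v) mod h,
      one = 1 mod h,
      zero = 0,
      add = \<lambda>u v. (u + v) mod h\<rparr>"

text \<open>
  Over a \<^class>\<open>field_gcd\<close>, the gcd of two polynomials that are not both zero is monic.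
\<close>

definition gcd_graph :: "'a::field_gcd poly \<Rightarrow> 'a poly set \<Rightarrow> 'a poly pair_pre_digraph" where
  "gcd_graph f D =
     \<lparr>pverts = carrier (poly_residue_ring f),
      parcs = {(u, v). u \<in> carrier (poly_residue_ring f) \<and> v \<in> carrier (poly_residue_ring f)
                     \<and> gcd (u - v) f \<in> D}\<rparr>"

definition adjacency_matrix :: "'v list \<Rightarrow> 'v pair_pre_digraph \<Rightarrow> complex mat" where
  "adjacency_matrix vs G =
     mat (length vs) (length vs) (\<lambda>(i, j). if (vs ! i, vs ! j) \<in> parcs G then 1 else 0)"

definition nondegenerate_functional :: "'a::field poly \<Rightarrow> ('a poly \<Rightarrow> 'a) \<Rightarrow> bool" where
  "nondegenerate_functional h \<psi> \<longleftrightarrow>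
     (\<forall>u \<in> carrier (poly_residue_ring h). \<forall>v \<in> carrier (poly_residue_ring h).
        \<psi> (u + v) = \<psi> u + \<psi> v) \<and>
     (\<forall>c. \<forall>u \<in> carrier (poly_residue_ring h). \<psi> (Polynomial.smult c u) = c * \<psi> u) \<and>
     (\<forall>J. ideal J (poly_residue_ring h) \<and> J \<subseteq> {u \<in> carrier (poly_residue_ring h). \<psi> u = 0}
        \<longrightarrow> J = {0})"

text \<open>The trace \<open>F\<^sub>q \<rightarrow> F\<^sub>p\<close> as the sum of the \<open>n\<close> Frobenius conjugates, \<open>q = p\<^sup>n\<close>, with values in
  the prime subfield of \<open>F\<^sub>q\<close>.\<close>

definition absolute_trace :: "'a::{field, finite} \<Rightarrow> 'a" where
  "absolute_trace x = (\<Sum>i < (THE n. CARD('a) = CHAR('a) ^ n). x ^ (CHAR('a) ^ i))"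

text \<open>The representative in \<open>{0..<p}\<close> of an element of the prime subfield.\<close>

definition prime_field_rep :: "'a::{field, finite} \<Rightarrow> nat" where
  "prime_field_rep t = (LEAST k. of_nat k = t)"

definition primitive_root_of_unity :: "nat \<Rightarrow> complex \<Rightarrow> bool" where
  "primitive_root_of_unity n z \<longleftrightarrow> n > 0 \<and> z ^ n = 1 \<and> (\<forall>k. 0 < k \<and> k < n \<longrightarrow> z ^ k \<noteq> 1)"

text \<open>
  For a non-degenerate \<open>\<psi>\<close> the value does not depend on \<open>\<psi>\<close>; the functional is kept as an explicit
  argument so that statements can be made for an arbitrary choice of it.
\<close>

definition ramanujan_sum ::
  "complex \<Rightarrow> ('a::{field, finite} poly \<Rightarrow> 'a) \<Rightarrow> 'a poly \<Rightarrow> 'a poly \<Rightarrow> complex" where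
  "ramanujan_sum \<zeta> \<psi> g h =
     (\<Sum>a \<in> Units (poly_residue_ring h). \<zeta> ^ prime_field_rep (absolute_trace (\<psi> ((g * a) mod h))))"


lemma poly_residue_ring_cring: "cring (poly_residue_ring h)"
proof -
  have ex: "\<exists>y. y mod h = y \<and> (x + y) mod h = 0" if "x mod h = x" for x :: "'a poly"
    using that by (intro exI[of _ "- x"]) (auto simp: poly_mod_minus_left)
  show ?thesis
    by (intro cringI abelian_groupI comm_monoidI)
       (auto simp: poly_residue_ring_def mod_simps intro: ex simp: algebra_simps)
qed

lemma finite_carrier_poly_residue_ring:
  fixes h :: "'a::{field, finite} poly"
  assumes "h \<noteq> 0"
  shows "finite (carrier (poly_residue_ring h))"
proof (rule finite_subset)
  show "carrier (poly_residue_ring h) \<subseteq> Poly ` {xs. set xs \<subseteq> UNIV \<and> length xs \<le> Suc (degree h)}"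
  proof
    fix u assume "u \<in> carrier (poly_residue_ring h)"
    then have "degree u \<le> degree h"
      using degree_mod_less[OF assms, of u] by (auto simp: poly_residue_ring_def)
    then have "length (coeffs u) \<le> Suc (degree h)"
      by (cases "u = 0") (auto simp: length_coeffs)
    then show "u \<in> Poly ` {xs. set xs \<subseteq> UNIV \<and> length xs \<le> Suc (degree h)}"
      by (intro image_eqI[of _ _ "coeffs u"]) auto
  qed
  show "finite (Poly ` {xs :: 'a list. set xs \<subseteq> UNIV \<and> length xs \<le> Suc (degree h)})"
    by (intro finite_imageI finite_lists_length_le) simp
qed

lemma monic_gcd:
  fixes f :: "'a::field_gcd poly"
  assumes "f \<noteq> 0"
  shows "monic (gcd u f)"
proof -
  let ?g = "gcd u f"
  have g0: "?g \<noteq> 0" using assms by simp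
  have "[:unit_factor (lead_coeff ?g):] = 1"
    using g0 unit_factor_gcd[of u f] by (simp add: unit_factor_poly_def)
  then have "unit_factor (lead_coeff ?g) = 1" by (simp add: one_pCons)
  moreover have "lead_coeff ?g dvd 1" using g0 by (simp add: dvd_field_iff)
  ultimately show ?thesis by (metis is_unit_unit_factor)
qed

lemma pair_graph_gcd_graph:
  fixes f :: "'a::{finite, field_gcd} poly"
  assumes "monic f" "f \<notin> D"
  shows "pair_graph (gcd_graph f D)"
proof -
  let ?V = "carrier (poly_residue_ring f)"
  have f0: "f \<noteq> 0" using assms by auto
  have gf: "gcd 0 f = f"
    using assms by (simp add: normalize_poly_def one_pCons[symmetric])
  have "gcd (v - u) f = gcd (u - v) f" for u v
    by (metis gcd_neg1 minus_diff_eq)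
  then have "symmetric (with_proj (gcd_graph f D))"
    by (auto simp: symmetric_def gcd_graph_def sym_def)
  moreover have "finite (parcs (gcd_graph f D))"
    by (rule finite_subset[of _ "?V \<times> ?V"])
       (auto simp: gcd_graph_def finite_carrier_poly_residue_ring[OF f0])
  ultimately show ?thesis
    using gf assms finite_carrier_poly_residue_ring[OF f0]
    by unfold_locales (auto simp: gcd_graph_def)
qed

text \<open>The functional extracting the coefficient of \<open>x^(deg h - 1)\<close> is non-degenerate.\<close>

lemma nondegenerate_functional_top_coeff:
  fixes h :: "'a::field poly"
  assumes "monic h"
  shows "nondegenerate_functional h
           (\<lambda>u. if degree h = 0 then 0 else Polynomial.coeff u (degree h - 1))"
proof (cases "degree h = 0")
  case True
  with assms have h: "h = 1" by (metis monic_degree_0)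
  have "J = {0}" if "ideal J (poly_residue_ring 1)" for J :: "'a poly set"
  proof -
    interpret ideal J "poly_residue_ring 1" by (fact that)
    show ?thesis using a_subset additive_subgroup.zero_closed[OF is_additive_subgroup]
      by (auto simp: poly_residue_ring_def)
  qed
  with True h show ?thesis by (auto simp: nondegenerate_functional_def)
next
  case False
  have h0: "h \<noteq> 0" using False by auto
  have "J = {0}" if J: "ideal J (poly_residue_ring h)"
    and ker: "J \<subseteq> {u \<in> carrier (poly_residue_ring h). Polynomial.coeff u (degree h - 1) = 0}" for J
  proof (rule ccontr)
    assume "J \<noteq> {0}"
    interpret ideal J "poly_residue_ring h" by (fact J)
    have "0 \<in> J" using additive_subgroup.zero_closed[OF is_additive_subgroup] by (simp add: poly_residue_ring_def)
    with \<open>J \<noteq> {0}\<close> obtain u where u: "u \<in> J" "u \<noteq> 0" by blast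
    have "u mod h = u" using ker u by (auto simp: poly_residue_ring_def)
    then have du: "degree u < degree h"
      using degree_mod_less[OF h0, of u] False by auto
    define m where "m = degree h - 1 - degree u"
    have dm: "degree (monom 1 m * u) = degree h - 1"
      using u du by (simp add: degree_mult_eq degree_monom_eq m_def)
    have small: "w mod h = w" if "degree w < degree h" for w :: "'a poly"
      using that by (simp add: mod_poly_less)
    have "monom 1 m mod h = monom 1 m"
      using du by (intro small) (simp add: degree_monom_eq m_def)
    then have "(monom 1 m * u) mod h \<in> J"
      using I_l_closed[OF u(1), of "monom 1 m"] by (simp add: poly_residue_ring_def)
    moreover have "(monom 1 m * u) mod h = monom 1 m * u"
      using du dm by (intro small) simp
    ultimately have "Polynomial.coeff (monom 1 m * u) (degree h - 1) = 0"
      using ker by auto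
    moreover have "monom 1 m * u \<noteq> 0" using u by simp
    ultimately show False using dm by (metis leading_coeff_0_iff)
  qed
  with False show ?thesis by (auto simp: nondegenerate_functional_def)
qed

end

theory Submission
  imports Defs "HOL-Algebra.Sylow"
begin

text \<open>
  The graph \<open>G_f(D)\<close> is a Cayley graph of the additive group of \<open>F[x]/(f)\<close>, whose connection set
  consists of the \<open>s\<close> with \<open>gcd(s, f) \<in> D\<close>. Hence the characters of that group are eigenvectors, and
  the eigenvalue of a character is its sum over the connection set. One non-degenerate
  functional on \<open>F[x]/(f)\<close>, followed by the trace and by \<open>k \<mapsto> \<zeta>\<^sup>k\<close>, gives a character \<open>\<chi>\<close> such that
  the \<open>s \<mapsto> \<chi>(g s)\<close>, for \<open>g\<close> modulo \<open>f\<close>, are mutually orthogonal. By Fourier inversion they span all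
  functions, and so there are no further eigenvalues (\<open>spectrum_gcd_graph_character\<close>).

  To evaluate the eigenvalue, split the connection set by the value \<open>d\<close> of \<open>gcd(s, f)\<close>. The \<open>s\<close> with
  a given \<open>d\<close> are the products \<open>d a\<close> with \<open>a\<close> a unit modulo \<open>f/d\<close>, so that they contribute a Ramanujan
  sum modulo \<open>f/d\<close>, formed with the character \<open>a \<mapsto> \<chi>(d a)\<close> (\<open>sum_gcd_class\<close>). This character
  comes from the functional chosen modulo \<open>f\<close> and need not be the one that \<open>\<psi> (f/d)\<close> induces;
  what is missing is that the Ramanujan sum does not depend on the functional.

  Independence and integrality have a common proof
  (\<open>character_ramanujan_sum_Ints_independent\<close>). The sum of a character over all of \<open>F[x]/(h)\<close> is
  the same integer for every admissible character, by orthogonality. The same splitting by \<open>gcd(s, h)\<close>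
  writes it as the sum of the Ramanujan sums modulo \<open>h/d\<close>, over the monic divisors \<open>d\<close> of \<open>h\<close>, and
  those with \<open>d \<noteq> 1\<close> are known by induction on the degree. Solving for the term with \<open>d = 1\<close> gives
  the claim.

  The notion that carries all this is \<open>primitive_character\<close>: it keeps from the functional, the trace
  and the root of unity only what the sums depend on, and composition with multiplication by \<open>d\<close>
  turns such a character modulo \<open>d h\<close> into one modulo \<open>h\<close>.
\<close>

section \<open>The trace of a finite field\<close>

lemma finite_field_power_card:
  fixes x :: "'a :: {finite, field}"
  shows "x ^ CARD('a) = x"
proof (cases "x = 0")
  case False
  \<comment> \<open>Multiplication by \<open>x\<close> permutes the nonzero elements, so both products below agree.\<close>
  have "x * (\<Prod>y\<in>UNIV-{0}. x * y) = x * x ^ (CARD('a) - 1) * \<Prod>(UNIV-{0})"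
    by (simp add: prod.distrib mult_ac)
  also have "x * x ^ (CARD('a) - 1) = x ^ Suc (CARD('a) - 1)"
    by (rule power_Suc[symmetric])
  also have "Suc (CARD('a) - 1) = CARD('a)"
    using finite_UNIV_card_ge_0[where ?'a = 'a] by simp
  also have "(\<Prod>y\<in>UNIV-{0}. x * y) = (\<Prod>y\<in>UNIV-{0}. y)"
    by (rule prod.reindex_bij_witness[of _ "\<lambda>y. y / x" "\<lambda>y. x * y"]) (use False in auto)
  finally show ?thesis
    by simp
qed (use finite_UNIV_card_ge_0[where ?'a = 'a] in auto)

lemma prime_CHAR_finite_field: "prime CHAR('a :: {finite, field})"
  by (intro prime_CHAR_semidom finite_imp_CHAR_pos) auto

text \<open>
  Sylow's theorem supplies an additive subgroup of order \<open>r\<close>. Translation by one of its nonzero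
  elements \<open>x\<close> preserves the sum of all its elements, whence \<open>r x = 0\<close>.
\<close>

lemma prime_dvd_CARD_eq_CHAR:
  assumes "prime r" "r dvd CARD('a :: {finite, field})"
  shows "r = CHAR('a)"
proof -
  define G where "G = \<lparr>carrier = (UNIV :: 'a set), monoid.mult = (+), one = (0 :: 'a)\<rparr>"
  have "group G"
    by (rule groupI) (auto simp: G_def add.assoc intro: exI[of _ "- x" for x])
  moreover from assms obtain m where "CARD('a) = r * m" by blast
  then have "order G = r ^ 1 * m" by (simp add: G_def order_def)
  ultimately obtain H where H: "subgroup H G" "card H = r"
    using sylow_thm[OF assms(1), of G 1 m] by (auto simp: G_def)
  have "\<not> H \<subseteq> {0}"
    using H(2) prime_gt_1_nat[OF assms(1)] card_mono[of "{0 :: 'a}" H] by auto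
  then obtain x where x: "x \<in> H" "x \<noteq> 0" by blast
  have closed: "x + y \<in> H" if "y \<in> H" for y
    using subgroup.m_closed[OF H(1) x(1) that] by (simp add: G_def)
  have "(+) x ` H = H"
    by (rule endo_inj_surj) (use closed in \<open>auto intro: inj_onI\<close>)
  then have "(\<Sum>y\<in>H. x + y) = (\<Sum>y\<in>H. y)"
    using sum.reindex[of "(+) x" H "\<lambda>y. y"] by (simp add: inj_on_def)
  then have "of_nat r * x = 0" by (simp add: sum.distrib H(2))
  then have "CHAR('a) dvd r" using x by (simp add: of_nat_eq_0_iff_char_dvd)
  then show ?thesis
    using assms(1) prime_CHAR_finite_field[where 'a='a] primes_dvd_imp_eq by metis
qed

text \<open>
  This identifies the number of conjugates in \<^const>\<open>absolute_trace\<close>, which is defined by a definite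
  description.
\<close>

lemma CARD_eq_CHAR_power:
  obtains n where "n > 0" "CARD('a :: {finite, field}) = CHAR('a) ^ n"
proof -
  let ?p = "CHAR('a)"
  have p: "prime ?p" by (rule prime_CHAR_finite_field)
  have "CARD('a) \<noteq> 0" by simp
  then obtain m where m: "CARD('a) = ?p ^ multiplicity ?p CARD('a) * m" "\<not> ?p dvd m"
    using multiplicity_decompose'[of "CARD('a)" ?p] p by (metis not_prime_unit)
  have "m = 1"
  proof (rule ccontr)
    assume "m \<noteq> 1"
    then obtain r where "prime r" "r dvd m" using prime_factor_nat by blast
    then have "r = ?p" using m(1) by (intro prime_dvd_CARD_eq_CHAR) (metis dvd_mult)+
    with \<open>r dvd m\<close> m(2) show False by simp
  qed
  with m have eq: "CARD('a) = ?p ^ multiplicity ?p CARD('a)" by simp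
  have "CARD('a) > 1" using card_mono[of UNIV "{0, 1 :: 'a}"] by simp
  with eq have "multiplicity ?p CARD('a) > 0" by (metis gr0I less_irrefl power_0)
  with eq that show ?thesis by blast
qed

lemma absolute_trace_eq:
  assumes "CARD('a :: {finite, field}) = CHAR('a) ^ n"
  shows "absolute_trace (x :: 'a) = (\<Sum>i<n. x ^ (CHAR('a) ^ i))"
proof -
  have "(THE n. CARD('a) = CHAR('a) ^ n) = n"
    using assms prime_gt_1_nat[OF prime_CHAR_finite_field[where 'a='a]]
    by (intro the_equality) (auto dest: power_inject_exp[THEN iffD1, rotated])
  then show ?thesis by (simp add: absolute_trace_def)
qed

lemma absolute_trace_add:
  "absolute_trace (x + y) = absolute_trace x + absolute_trace (y :: 'a :: {finite, field})"
  by (rule CARD_eq_CHAR_power[where 'a='a])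
     (simp add: absolute_trace_eq sum.distrib freshmans_dream'[OF prime_CHAR_finite_field])

text \<open>
  The Frobenius map permutes the conjugates cyclically, since \<open>x\<^sup>q = x\<close>.
\<close>

lemma absolute_trace_power_CHAR:
  "absolute_trace (x :: 'a :: {finite, field}) ^ CHAR('a) = absolute_trace x"
proof -
  let ?p = "CHAR('a)"
  obtain n where n: "n > 0" "CARD('a) = ?p ^ n" by (rule CARD_eq_CHAR_power)
  have shift: "(\<Sum>i<n. g (Suc i)) + g 0 = (\<Sum>i<n. g i) + g n" for g :: "nat \<Rightarrow> 'a"
    by (induction n) (simp_all add: algebra_simps)
  have "absolute_trace x ^ ?p = (\<Sum>i<n. x ^ ?p ^ Suc i)"
    by (simp add: absolute_trace_eq[OF n(2)] freshmans_dream_sum[OF prime_CHAR_finite_field]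
        mult.commute flip: power_mult)
  also have "\<dots> + x ^ ?p ^ 0 = (\<Sum>i<n. x ^ ?p ^ i) + x ^ ?p ^ n"
    by (rule shift)
  also have "x ^ ?p ^ n = x ^ ?p ^ 0" by (simp add: finite_field_power_card flip: n(2))
  finally show ?thesis by (simp add: absolute_trace_eq[OF n(2)])
qed

text \<open>
  The trace is a nonzero polynomial function of degree at most \<open>p\<^sup>n\<^sup>-\<^sup>1\<close>, too small for all \<open>p\<^sup>n\<close> elements of
  the field to be roots.
\<close>

lemma absolute_trace_nonzero: "\<exists>x :: 'a :: {finite, field}. absolute_trace x \<noteq> 0"
proof (rule ccontr)
  assume "\<not> ?thesis"
  let ?p = "CHAR('a)"
  obtain n where n: "n > 0" "CARD('a) = ?p ^ n" by (rule CARD_eq_CHAR_power)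
  have p: "?p > 1" by (rule prime_gt_1_nat[OF prime_CHAR_finite_field])
  define P where "P = (\<Sum>i<n. Polynomial.monom (1 :: 'a) (?p ^ i))"
  have "poly P x = absolute_trace x" for x
    by (simp add: P_def poly_sum poly_monom absolute_trace_eq[OF n(2)])
  with \<open>\<not> ?thesis\<close> have roots: "{x. poly P x = 0} = UNIV" by auto
  \<comment> \<open>The exponents \<open>p\<^sup>i\<close> are distinct, so that the coefficient of \<open>x\<close> comes from \<open>i = 0\<close> alone.\<close>
  have "Polynomial.coeff P (?p ^ 0) = (\<Sum>i<n. if i = 0 then 1 else 0)"
    unfolding P_def coeff_sum using p
    by (intro sum.cong) (auto simp del: power_0 dest!: power_inject_exp[THEN iffD1, rotated])
  then have "P \<noteq> 0" using n(1) by auto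
  then have "?p ^ n \<le> degree P" using card_poly_roots_bound[of P] n(2) roots by simp
  also have "degree P \<le> ?p ^ (n - 1)"
    unfolding P_def using p n(1)
    by (intro degree_sum_le) (auto intro!: order.trans[OF degree_monom_le] power_increasing)
  finally show False using p n(1) by simp
qed

text \<open>
  The polynomial \<open>x\<^sup>p - x\<close> has at most \<open>p\<close> roots, and the \<open>p\<close> images of natural numbers are roots.
\<close>

lemma prime_subfield_of_nat:
  fixes x :: "'a :: {finite, field}"
  assumes "x ^ CHAR('a) = x"
  obtains k where "k < CHAR('a)" "x = of_nat k"
proof -
  let ?p = "CHAR('a)"
  have p: "prime ?p" by (rule prime_CHAR_finite_field)
  define P where "P = Polynomial.monom (1 :: 'a) ?p - Polynomial.monom 1 1"
  have "Polynomial.coeff P ?p = 1"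
    using prime_gt_1_nat[OF p] by (simp add: P_def)
  then have "P \<noteq> 0" by auto
  have "degree P \<le> ?p" unfolding P_def using prime_gt_1_nat[OF p]
    by (intro degree_diff_le order.trans[OF degree_monom_le]) auto
  with card_poly_roots_bound[OF \<open>P \<noteq> 0\<close>] have le: "card {x. poly P x = 0} \<le> ?p" by simp
  have frob: "(of_nat k :: 'a) ^ ?p = of_nat k" for k
    using prime_gt_0_nat[OF p]
    by (induction k) (simp_all add: power_0_left freshmans_dream[OF p])
  have "inj_on (of_nat :: nat \<Rightarrow> 'a) {..<?p}"
  proof (rule linorder_inj_onI)
    fix i j assume "i < j" "j \<in> {..<?p}"
    then have "\<not> ?p dvd j - i" by (auto dest: dvd_imp_le)
    then show "(of_nat i :: 'a) \<noteq> of_nat j" using of_nat_eq_iff_char_dvd[OF \<open>i < j\<close>] by blast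
  qed auto
  then have "card (of_nat ` {..<?p} :: 'a set) = ?p" by (simp add: card_image)
  moreover have "of_nat ` {..<?p} \<subseteq> {x. poly P x = 0}"
    by (auto simp: P_def poly_monom frob)
  ultimately have "of_nat ` {..<?p} = {x. poly P x = 0}"
    using le by (intro card_seteq) auto
  moreover have "poly P x = 0" using assms by (simp add: P_def poly_monom)
  ultimately show ?thesis using that by blast
qed

section \<open>Primitive additive characters modulo a polynomial\<close>

definition trace_character :: "complex \<Rightarrow> 'a :: {finite, field} \<Rightarrow> complex" where
  "trace_character \<zeta> t = \<zeta> ^ prime_field_rep (absolute_trace t)"

text \<open>
  Any natural number that represents the trace may replace the least one; this makes the
  additivity of the character visible.
\<close>

lemma trace_character_of_nat:
  fixes t :: "'a :: {finite, field}"
  assumes "\<zeta> ^ CHAR('a) = 1" "absolute_trace t = of_nat k"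
  shows "trace_character \<zeta> t = \<zeta> ^ k"
proof -
  have period: "\<zeta> ^ i = \<zeta> ^ j" if "(of_nat i :: 'a) = of_nat j" "i < j" for i j
  proof -
    from that obtain l where "j - i = CHAR('a) * l"
      using of_nat_eq_iff_char_dvd[where 'a='a] by (metis dvdE)
    with that have "j = i + CHAR('a) * l" by simp
    with assms(1) show ?thesis by (simp add: power_add power_mult)
  qed
  have "of_nat (prime_field_rep (of_nat k :: 'a)) = (of_nat k :: 'a)"
    unfolding prime_field_rep_def by (rule LeastI) simp
  then have "\<zeta> ^ prime_field_rep (of_nat k :: 'a) = \<zeta> ^ k"
    using period by (metis linorder_neqE_nat)
  with assms(2) show ?thesis by (simp add: trace_character_def)
qed

lemma trace_character_add:
  fixes s t :: "'a :: {finite, field}"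
  assumes "\<zeta> ^ CHAR('a) = 1"
  shows "trace_character \<zeta> (s + t) = trace_character \<zeta> s * trace_character \<zeta> t"
proof -
  obtain k where k: "absolute_trace s = of_nat k"
    using prime_subfield_of_nat[OF absolute_trace_power_CHAR] by metis
  obtain l where l: "absolute_trace t = of_nat l"
    using prime_subfield_of_nat[OF absolute_trace_power_CHAR] by metis
  have "absolute_trace (s + t) = of_nat (k + l)" by (simp add: absolute_trace_add k l)
  from trace_character_of_nat[OF assms this] show ?thesis
    by (simp add: trace_character_of_nat[OF assms k] trace_character_of_nat[OF assms l] power_add)
qed

lemma trace_character_nontrivial:
  assumes "primitive_root_of_unity CHAR('a) \<zeta>"
  obtains t :: "'a :: {finite, field}" where "trace_character \<zeta> t \<noteq> 1"
proof -
  obtain t :: 'a where t: "absolute_trace t \<noteq> 0" using absolute_trace_nonzero by blast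
  obtain k where k: "k < CHAR('a)" "absolute_trace t = of_nat k"
    using prime_subfield_of_nat[OF absolute_trace_power_CHAR] by metis
  have "k \<noteq> 0" using k t by (metis of_nat_0)
  then have "trace_character \<zeta> t \<noteq> 1"
    using assms k trace_character_of_nat[of \<zeta> t k] by (auto simp: primitive_root_of_unity_def)
  then show ?thesis by (rule that)
qed

text \<open>
  Functions on \<open>F[x]/(h)\<close> are represented by functions on \<open>F[x]\<close> that are invariant under adding
  multiples of \<open>h\<close>, which is what the first two conjuncts give together. In this form composition
  with a multiplication \<open>u \<mapsto> d u\<close> needs no reduction of representatives. The last conjunct says that
  the kernel contains no nonzero ideal of \<open>F[x]/(h)\<close>.
\<close>

definition primitive_character :: "'a :: field poly \<Rightarrow> ('a poly \<Rightarrow> complex) \<Rightarrow> bool" where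
  "primitive_character h \<chi> \<longleftrightarrow>
     (\<forall>u v. \<chi> (u + v) = \<chi> u * \<chi> v) \<and> (\<forall>u. \<chi> (h * u) = 1) \<and>
     (\<forall>u. (\<forall>a. \<chi> (a * u) = 1) \<longrightarrow> h dvd u)"

text \<open>
  The kernel condition, applied to the principal ideal that \<open>u\<close> generates.
\<close>

lemma nondegenerate_functional_nonzero:
  assumes "nondegenerate_functional h \<psi>" "\<not> h dvd u"
  obtains a where "\<psi> ((a * u) mod h) \<noteq> 0"
proof -
  interpret cring "poly_residue_ring h" by (rule poly_residue_ring_cring)
  let ?J = "PIdl\<^bsub>poly_residue_ring h\<^esub> (u mod h)"
  have u: "u mod h \<in> carrier (poly_residue_ring h)" by (simp add: poly_residue_ring_def)
  have "ideal ?J (poly_residue_ring h)" by (rule cgenideal_ideal[OF u])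
  moreover have "?J \<noteq> {0}" using cgenideal_self[OF u] assms(2) by (auto simp: dvd_eq_mod_eq_0)
  ultimately obtain v where "v \<in> ?J" "\<psi> v \<noteq> 0" "v \<in> carrier (poly_residue_ring h)"
  proof -
    have "\<not> ?J \<subseteq> {u \<in> carrier (poly_residue_ring h). \<psi> u = 0}"
      using assms(1) \<open>ideal _ _\<close> \<open>?J \<noteq> {0}\<close> unfolding nondegenerate_functional_def by blast
    moreover have "?J \<subseteq> carrier (poly_residue_ring h)"
      using \<open>ideal _ _\<close> by (simp add: additive_subgroup.a_subset ideal.axioms(1))
    ultimately show ?thesis using that by blast
  qed
  then obtain a where "v = (a * u) mod h"
    by (auto simp: cgenideal_def poly_residue_ring_def mod_mult_right_eq)
  with \<open>\<psi> v \<noteq> 0\<close> that show ?thesis by blast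
qed

lemma primitive_character_functional:
  fixes h :: "'a :: {finite, field} poly"
  assumes \<zeta>: "primitive_root_of_unity CHAR('a) \<zeta>" and \<psi>: "nondegenerate_functional h \<psi>"
  shows "primitive_character h (\<lambda>u. trace_character \<zeta> (\<psi> (u mod h)))"
  unfolding primitive_character_def
proof (intro conjI allI impI)
  have \<zeta>1: "\<zeta> ^ CHAR('a) = 1" using \<zeta> by (simp add: primitive_root_of_unity_def)
  have add: "\<psi> ((u + v) mod h) = \<psi> (u mod h) + \<psi> (v mod h)" for u v
    using \<psi> by (simp add: nondegenerate_functional_def poly_residue_ring_def poly_mod_add_left)
  have smult: "\<psi> (Polynomial.smult c u mod h) = c * \<psi> (u mod h)" for c u
    using \<psi> by (simp add: nondegenerate_functional_def poly_residue_ring_def mod_smult_left)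
  show "trace_character \<zeta> (\<psi> ((u + v) mod h)) =
      trace_character \<zeta> (\<psi> (u mod h)) * trace_character \<zeta> (\<psi> (v mod h))" for u v
    by (simp add: add trace_character_add[OF \<zeta>1])
  have "absolute_trace (0 :: 'a) + absolute_trace 0 = absolute_trace 0 + 0"
    by (simp flip: absolute_trace_add)
  then have "absolute_trace (0 :: 'a) = of_nat 0" by (simp only: add_left_cancel of_nat_0)
  moreover have "\<psi> 0 = 0" using smult[of 0 0] by simp
  ultimately show "trace_character \<zeta> (\<psi> (h * u mod h)) = 1" for u
    using trace_character_of_nat[OF \<zeta>1, of 0 0] by simp
  show "h dvd u" if *: "\<forall>a. trace_character \<zeta> (\<psi> (a * u mod h)) = 1" for u
  proof (rule ccontr)
    assume "\<not> h dvd u"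
    with \<psi> obtain a where a: "\<psi> (a * u mod h) \<noteq> 0" by (rule nondegenerate_functional_nonzero)
    obtain t :: 'a where t: "trace_character \<zeta> t \<noteq> 1" by (rule trace_character_nontrivial[OF \<zeta>])
    \<comment> \<open>Linearity over the whole field lets a nonzero value be scaled to any prescribed \<open>t\<close>.\<close>
    have "\<psi> (Polynomial.smult (t / \<psi> (a * u mod h)) a * u mod h) = t"
      using a by (simp add: smult)
    with t * show False by metis
  qed
qed

lemma primitive_character_0:
  assumes "primitive_character h \<chi>" shows "\<chi> 0 = 1"
  using assms unfolding primitive_character_def by (metis mult_zero_right)

lemma primitive_character_mod:
  assumes "primitive_character h \<chi>" shows "\<chi> (g * (u mod h)) = \<chi> (g * u)"
proof -
  have "\<chi> (g * u) = \<chi> (h * (g * (u div h)) + g * (u mod h))"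
    by (simp flip: distrib_left add: mult.left_commute[of h])
  with assms show ?thesis by (simp add: primitive_character_def)
qed

text \<open>
  A primitive character modulo \<open>f\<close> yields one modulo each quotient \<open>f/d\<close>: the ideal generated by
  \<open>u\<close> modulo \<open>f/d\<close> corresponds to the one generated by \<open>d u\<close> modulo \<open>f\<close>.
\<close>

lemma primitive_character_mult:
  assumes "primitive_character (d * h) \<chi>" "d \<noteq> 0"
  shows "primitive_character h (\<lambda>u. \<chi> (d * u))"
  unfolding primitive_character_def
proof (intro conjI allI impI)
  show "\<chi> (d * (u + v)) = \<chi> (d * u) * \<chi> (d * v)" for u v
    using assms by (simp add: primitive_character_def distrib_left)
  show "\<chi> (d * (h * u)) = 1" for u
    using assms by (simp add: primitive_character_def mult.assoc)
  show "h dvd u" if "\<forall>a. \<chi> (d * (a * u)) = 1" for u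
  proof -
    have "\<forall>a. \<chi> (a * (d * u)) = 1" using that by (simp add: mult.left_commute)
    then have "d * h dvd d * u" using assms(1) unfolding primitive_character_def by blast
    with assms(2) show ?thesis by simp
  qed
qed

lemma bij_betw_residue_shift:
  fixes f :: "'a :: field poly"
  shows "bij_betw (\<lambda>s. (u + s) mod f) (carrier (poly_residue_ring f)) (carrier (poly_residue_ring f))"
  by (rule bij_betw_byWitness[where f' = "\<lambda>w. (w - u) mod f"])
     (auto simp: poly_residue_ring_def mod_simps)

text \<open>
  If \<open>\<chi> (g b) \<noteq> 1\<close>, then shifting the summation variable by \<open>b\<close> multiplies the sum by \<open>\<chi> (g b)\<close>, so
  the sum vanishes.
\<close>

lemma primitive_character_orthogonality:
  fixes h :: "'a :: {finite, field} poly"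
  assumes \<chi>: "primitive_character h \<chi>"
  shows "(\<Sum>a\<in>carrier (poly_residue_ring h). \<chi> (g * a)) =
      (if h dvd g then of_nat (card (carrier (poly_residue_ring h))) else 0)"
proof (cases "h dvd g")
  case True
  then have "\<chi> (g * a) = 1" for a
    using \<chi> by (auto simp: primitive_character_def mult.assoc)
  with True show ?thesis by simp
next
  case False
  then obtain b where "\<chi> (b * g) \<noteq> 1"
    using \<chi> unfolding primitive_character_def by blast
  then have b: "\<chi> (g * b) \<noteq> 1" by (simp add: mult.commute)
  let ?S = "\<Sum>a\<in>carrier (poly_residue_ring h). \<chi> (g * a)"
  have "?S = (\<Sum>a\<in>carrier (poly_residue_ring h). \<chi> (g * ((b + a) mod h)))"
    by (rule sum.reindex_bij_betw[OF bij_betw_residue_shift, symmetric])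
  also have "\<dots> = \<chi> (g * b) * ?S"
    using \<chi> unfolding sum_distrib_left primitive_character_mod[OF \<chi>]
    by (simp add: primitive_character_def distrib_left)
  finally show ?thesis using b False by simp
qed

section \<open>Ramanujan sums\<close>

definition character_ramanujan_sum ::
  "('a :: field_gcd poly \<Rightarrow> complex) \<Rightarrow> 'a poly \<Rightarrow> 'a poly \<Rightarrow> complex" where
  "character_ramanujan_sum \<chi> g h =
     (\<Sum>a | a \<in> carrier (poly_residue_ring h) \<and> coprime a h. \<chi> (g * a))"

text \<open>
  A Bezout identity for \<open>a\<close> and \<open>h\<close> is an inverse of \<open>a\<close> modulo \<open>h\<close>. This includes \<open>h = 1\<close>, where \<open>0\<close>
  is a unit and is coprime to \<open>1\<close>.
\<close>

lemma Units_poly_residue_ring: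
  fixes h :: "'a :: field_gcd poly"
  assumes "h \<noteq> 0"
  shows "Units (poly_residue_ring h) = {a \<in> carrier (poly_residue_ring h). coprime a h}"
proof (intro equalityI subsetI)
  fix a assume "a \<in> Units (poly_residue_ring h)"
  then obtain b where "a \<in> carrier (poly_residue_ring h)" and b: "(b * a) mod h = 1 mod h"
    by (auto simp: Units_def poly_residue_ring_def)
  moreover have "gcd ((b * a) mod h) h = gcd (1 mod h) h" by (simp only: b)
  then have "gcd (b * a) h = 1" using assms by simp
  then have "coprime (b * a) h" by (simp add: coprime_iff_gcd_eq_1)
  ultimately show "a \<in> {a \<in> carrier (poly_residue_ring h). coprime a h}" by simp
next
  fix a assume a: "a \<in> {a \<in> carrier (poly_residue_ring h). coprime a h}"
  then obtain x y where "x * a + y * h = 1"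
    using bezout_coefficients_fst_snd[of a h] by (metis (mono_tags) coprime_iff_gcd_eq_1 mem_Collect_eq)
  then have "(x * a) mod h = 1 mod h" by (metis mod_mult_self1)
  then have "\<exists>y\<in>{u. u mod h = u}. (y * a) mod h = 1 mod h \<and> (a * y) mod h = 1 mod h"
    by (intro bexI[of _ "x mod h"]) (simp_all add: mod_mult_left_eq mod_mult_right_eq mult.commute)
  with a show "a \<in> Units (poly_residue_ring h)"
    by (simp add: Units_def poly_residue_ring_def)
qed

lemma ramanujan_sum_eq_character:
  fixes h :: "'a :: {finite, field_gcd} poly"
  assumes "h \<noteq> 0"
  shows "ramanujan_sum \<zeta> \<psi> g h =
      character_ramanujan_sum (\<lambda>u. trace_character \<zeta> (\<psi> (u mod h))) g h"
  by (simp add: ramanujan_sum_def character_ramanujan_sum_def Units_poly_residue_ring[OF assms]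
      trace_character_def)

lemma normalize_monic_poly:
  fixes d :: "'a :: field_gcd poly"
  assumes "monic d" shows "normalize d = d"
  using assms by (simp add: normalize_poly_def one_pCons[symmetric])

text \<open>
  Multiplication by \<open>d\<close> is a bijection from the units modulo \<open>h\<close> onto the residues modulo \<open>d h\<close>
  whose gcd with \<open>d h\<close> is \<open>d\<close>.
\<close>

lemma sum_gcd_class:
  fixes f :: "'a :: field_gcd poly"
  assumes "monic d" "f = d * h"
  shows "(\<Sum>s | s \<in> carrier (poly_residue_ring f) \<and> gcd s f = d. \<chi> (g * s)) =
      character_ramanujan_sum (\<lambda>u. \<chi> (d * u)) g h"
proof -
  have d0: "d \<noteq> 0" using assms by auto
  have gcd_d: "gcd (d * a) f = d \<longleftrightarrow> coprime a h" for a
  proof -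
    have "gcd (d * a) f = d * gcd a h"
      using assms by (simp add: gcd_mult_left normalize_mult normalize_monic_poly)
    with d0 show ?thesis by (simp add: coprime_iff_gcd_eq_1)
  qed
  have mem: "d * a \<in> carrier (poly_residue_ring f) \<longleftrightarrow> a \<in> carrier (poly_residue_ring h)" for a
    using d0 by (simp add: poly_residue_ring_def assms(2) mod_mult_mult1)
  have "bij_betw ((*) d) {a. a \<in> carrier (poly_residue_ring h) \<and> coprime a h}
      {s. s \<in> carrier (poly_residue_ring f) \<and> gcd s f = d}"
  proof (rule bij_betw_imageI)
    show "inj_on ((*) d) {a. a \<in> carrier (poly_residue_ring h) \<and> coprime a h}"
      using d0 by (auto intro: inj_onI)
    show "(*) d ` {a. a \<in> carrier (poly_residue_ring h) \<and> coprime a h} =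
        {s. s \<in> carrier (poly_residue_ring f) \<and> gcd s f = d}"
    proof (intro equalityI subsetI)
      fix s assume "s \<in> (*) d ` {a. a \<in> carrier (poly_residue_ring h) \<and> coprime a h}"
      then show "s \<in> {s. s \<in> carrier (poly_residue_ring f) \<and> gcd s f = d}"
        by (auto simp: gcd_d mem)
    next
      fix s assume s: "s \<in> {s. s \<in> carrier (poly_residue_ring f) \<and> gcd s f = d}"
      then have "d dvd s" by auto
      then obtain a where a: "s = d * a" by blast
      with s show "s \<in> (*) d ` {a. a \<in> carrier (poly_residue_ring h) \<and> coprime a h}"
        by (auto simp: gcd_d mem)
    qed
  qed
  from sum.reindex_bij_betw[OF this, of "\<lambda>s. \<chi> (g * s)"] show ?thesis
    by (simp add: character_ramanujan_sum_def mult.left_commute)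
qed

text \<open>
  Classifying the residues modulo \<open>h\<close> by their gcd with \<open>h\<close> expresses a sum known from
  orthogonality through the Ramanujan sums modulo the quotients \<open>h/d\<close>. All of these but the one for
  \<open>d = 1\<close> have a modulus of smaller degree. The constant is chosen before the character, so that
  one statement gives integrality and independence of the character, and the induction needs both.
\<close>

lemma character_ramanujan_sum_Ints_independent:
  fixes h :: "'a :: {finite, field_gcd} poly"
  assumes "monic h"
  shows "\<exists>c\<in>\<int>. \<forall>\<chi>. primitive_character h \<chi> \<longrightarrow> character_ramanujan_sum \<chi> g h = c"
  using assms
proof (induction "degree h" arbitrary: h rule: less_induct)
  case less
  let ?V = "carrier (poly_residue_ring h)"
  \<comment> \<open>These are the monic divisors of \<open>h\<close>; as an image the set is visibly finite.\<close>
  let ?E = "(\<lambda>s. gcd s h) ` ?V"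
  have h0: "h \<noteq> 0" using less.prems by auto
  have fin: "finite ?V" by (rule finite_carrier_poly_residue_ring[OF h0])
  have E: "monic d \<and> d * (h div d) = h \<and> d \<noteq> 0" if "d \<in> ?E" for d
    using that monic_gcd[OF h0] h0 by auto
  have one: "1 \<in> ?E"
  proof (rule image_eqI[of _ _ "1 mod h"])
    show "1 = gcd (1 mod h) h" using gcd_mod_left[OF h0, of 1] by simp
  qed (simp add: poly_residue_ring_def)
  have "\<exists>c\<in>\<int>. \<forall>\<chi>. primitive_character (h div d) \<chi> \<longrightarrow> character_ramanujan_sum \<chi> g (h div d) = c"
    if "d \<in> ?E - {1}" for d
  proof (rule less.hyps)
    from that E have d: "monic d" "d * (h div d) = h" "d \<noteq> 0" "d \<noteq> 1" by auto
    then have "h div d \<noteq> 0" using h0 by auto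
    with d have "degree h = degree d + degree (h div d)" by (metis degree_mult_eq)
    moreover have "degree d \<noteq> 0" using d monic_degree_0 by blast
    ultimately show "degree (h div d) < degree h" by simp
    from d less.prems show "monic (h div d)" by (metis lead_coeff_mult mult_1)
  qed
  then obtain c where c: "\<And>d. d \<in> ?E - {1} \<Longrightarrow> c d \<in> \<int>"
    "\<And>d \<chi>. d \<in> ?E - {1} \<Longrightarrow> primitive_character (h div d) \<chi> \<Longrightarrow>
       character_ramanujan_sum \<chi> g (h div d) = c d" by metis
  let ?N = "if h dvd g then of_nat (card ?V) else (0 :: complex)"
  have "character_ramanujan_sum \<chi> g h = ?N - (\<Sum>d\<in>?E - {1}. c d)"
    if \<chi>: "primitive_character h \<chi>" for \<chi>
  proof -
    have "?N = (\<Sum>a\<in>?V. \<chi> (g * a))"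
      by (rule primitive_character_orthogonality[OF \<chi>, symmetric])
    also have "\<dots> = (\<Sum>d\<in>?E. \<Sum>s | s \<in> ?V \<and> gcd s h = d. \<chi> (g * s))"
      by (rule sum.image_gen[OF fin])
    also have "\<dots> = (\<Sum>d\<in>?E. character_ramanujan_sum (\<lambda>u. \<chi> (d * u)) g (h div d))"
      by (intro sum.cong refl sum_gcd_class) (use E in \<open>auto dest: sym\<close>)
    also have "\<dots> = character_ramanujan_sum (\<lambda>u. \<chi> (1 * u)) g (h div 1) +
        (\<Sum>d\<in>?E - {1}. character_ramanujan_sum (\<lambda>u. \<chi> (d * u)) g (h div d))"
      by (rule sum.remove) (use fin one in auto)
    also have "(\<Sum>d\<in>?E - {1}. character_ramanujan_sum (\<lambda>u. \<chi> (d * u)) g (h div d)) =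
        (\<Sum>d\<in>?E - {1}. c d)"
    proof (intro sum.cong refl c(2))
      fix d assume "d \<in> ?E - {1}"
      with E have "d * (h div d) = h" "d \<noteq> 0" by auto
      with \<chi> show "primitive_character (h div d) (\<lambda>u. \<chi> (d * u))"
        by (intro primitive_character_mult) auto
    qed
    finally show ?thesis by simp
  qed
  moreover have "?N - (\<Sum>d\<in>?E - {1}. c d) \<in> \<int>" using c(1) by auto
  ultimately show ?case by blast
qed

section \<open>The spectrum of the graph\<close>

text \<open>
  Indexing vectors by vertices instead of by positions in the list frees the arguments that
  follow from matrices: the adjacency matrix acts by summation over neighbours.
\<close>

lemma spectrum_adjacency_matrix_iff:
  assumes "distinct vs"
  shows "k \<in> spectrum (adjacency_matrix vs G) \<longleftrightarrow>
     (\<exists>x. (\<exists>u\<in>set vs. x u \<noteq> 0) \<and>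
        (\<forall>u\<in>set vs. (\<Sum>w | w \<in> set vs \<and> (u, w) \<in> parcs G. x w) = k * x u))"
proof -
  let ?n = "length vs" and ?A = "adjacency_matrix vs G"
  have dim: "dim_row ?A = ?n" "dim_col ?A = ?n" by (simp_all add: adjacency_matrix_def)
  have apply_mat: "(?A *\<^sub>v vec ?n (\<lambda>i. x (vs ! i))) $ i =
      (\<Sum>w | w \<in> set vs \<and> (vs ! i, w) \<in> parcs G. x w)" if i: "i < ?n" for x i
  proof -
    have "(?A *\<^sub>v vec ?n (\<lambda>i. x (vs ! i))) $ i =
        (\<Sum>j<?n. if (vs ! i, vs ! j) \<in> parcs G then x (vs ! j) else 0)"
      using i by (auto simp: adjacency_matrix_def scalar_prod_def atLeast0LessThan intro!: sum.cong)
    also have "\<dots> = (\<Sum>w\<in>set vs. if (vs ! i, w) \<in> parcs G then x w else 0)"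
      by (rule sum.reindex_bij_betw[OF bij_betw_nth[OF assms]]) auto
    finally show ?thesis by (simp add: sum.inter_filter)
  qed
  have eigen: "eigenvector ?A (vec ?n (\<lambda>i. x (vs ! i))) k \<longleftrightarrow> (\<exists>u\<in>set vs. x u \<noteq> 0) \<and>
        (\<forall>u\<in>set vs. (\<Sum>w | w \<in> set vs \<and> (u, w) \<in> parcs G. x w) = k * x u)" for x
  proof -
    have "vec ?n (\<lambda>i. x (vs ! i)) \<noteq> 0\<^sub>v ?n \<longleftrightarrow> (\<exists>u\<in>set vs. x u \<noteq> 0)"
      by (auto simp: vec_eq_iff set_conv_nth)
    moreover have "?A *\<^sub>v vec ?n (\<lambda>i. x (vs ! i)) = k \<cdot>\<^sub>v vec ?n (\<lambda>i. x (vs ! i)) \<longleftrightarrow>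
        (\<forall>i<?n. (\<Sum>w | w \<in> set vs \<and> (vs ! i, w) \<in> parcs G. x w) = k * x (vs ! i))"
      by (auto simp: vec_eq_iff dim apply_mat simp del: index_mult_mat_vec)
    ultimately show ?thesis
      by (auto simp: eigenvector_def dim all_set_conv_all_nth)
  qed
  have vec_of_fun: "\<exists>x. v = vec ?n (\<lambda>i. x (vs ! i))" if "v \<in> carrier_vec ?n" for v :: "complex vec"
  proof (rule exI[of _ "\<lambda>w. v $ (THE i. i < ?n \<and> vs ! i = w)"], rule eq_vecI)
    fix i assume i: "i < dim_vec (vec ?n (\<lambda>i. v $ (THE j. j < ?n \<and> vs ! j = vs ! i)))"
    then have "(THE j. j < ?n \<and> vs ! j = vs ! i) = i"
      using assms by (intro the_equality) (auto simp: nth_eq_iff_index_eq)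
    with i show "v $ i = vec ?n (\<lambda>i. v $ (THE j. j < ?n \<and> vs ! j = vs ! i)) $ i" by simp
  qed (use that in auto)
  have "k \<in> spectrum ?A \<longleftrightarrow> (\<exists>x. eigenvector ?A (vec ?n (\<lambda>i. x (vs ! i))) k)"
  proof -
    have "v \<in> carrier_vec ?n" if "eigenvector ?A v k" for v
      using that by (simp add: eigenvector_def dim)
    with vec_of_fun show ?thesis unfolding spectrum_def eigenvalue_def by blast
  qed
  with eigen show ?thesis by simp
qed

text \<open>
  Each \<open>w \<mapsto> \<chi> (g w)\<close> is an eigenfunction because adjacency depends on differences only. If
  conversely \<open>x\<close> is an eigenfunction for \<open>k\<close>, then the symmetry of the adjacency relation shows that
  its Fourier coefficients \<open>X g = (\<Sum>w. \<chi> (g * w) * x w)\<close> satisfy \<open>k * X g = ev g * X g\<close>. They cannot all vanish,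
  since \<open>x\<close> is recovered from them, and a \<open>g\<close> with \<open>X g \<noteq> 0\<close> gives \<open>k = ev g\<close>.
  Here \<open>ev g\<close> is the character sum on the right-hand side.
\<close>

lemma spectrum_gcd_graph_character:
  fixes f :: "'a :: {finite, field_gcd} poly"
  assumes f: "f \<noteq> 0" and \<chi>: "primitive_character f \<chi>"
    and vs: "distinct vs" "set vs = pverts (gcd_graph f D)"
  shows "spectrum (adjacency_matrix vs (gcd_graph f D)) =
      (\<lambda>g. \<Sum>s | s \<in> carrier (poly_residue_ring f) \<and> gcd s f \<in> D. \<chi> (g * s)) `
        carrier (poly_residue_ring f)"
proof -
  let ?V = "carrier (poly_residue_ring f)"
  have fin: "finite ?V" by (rule finite_carrier_poly_residue_ring[OF f])
  have V: "set vs = ?V" using vs by (simp add: gcd_graph_def)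
  have add: "\<chi> (u + v) = \<chi> u * \<chi> v" for u v using \<chi> by (simp add: primitive_character_def)
  define nbrs where "nbrs u = {w \<in> ?V. gcd (u - w) f \<in> D}" for u
  have parcs: "{w. w \<in> set vs \<and> (u, w) \<in> parcs (gcd_graph f D)} = nbrs u" if "u \<in> ?V" for u
    using that by (auto simp: nbrs_def gcd_graph_def V)
  have gcd_sym: "gcd (u - w) f = gcd (w - u) f" for u w
    by (metis gcd_neg1 minus_diff_eq)
  define ev where "ev g = (\<Sum>s | s \<in> ?V \<and> gcd s f \<in> D. \<chi> (g * s))" for g
  have eigen: "(\<Sum>w\<in>nbrs u. \<chi> (g * w)) = ev g * \<chi> (g * u)" for g u
  proof -
    have "bij_betw (\<lambda>s. (u + s) mod f) {s \<in> ?V. gcd s f \<in> D} (nbrs u)"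
    proof (rule bij_betw_byWitness[where f' = "\<lambda>w. (w - u) mod f"])
      have "gcd (u - (u + s) mod f) f = gcd s f" for s
      proof -
        have "gcd (u - (u + s) mod f) f = gcd ((u - (u + s) mod f) mod f) f"
          by (simp only: gcd_mod_left[OF f])
        also have "(u - (u + s) mod f) mod f = (- s) mod f" by (simp add: mod_simps)
        also have "gcd ((- s) mod f) f = gcd s f" by (simp add: gcd_mod_left[OF f])
        finally show ?thesis .
      qed
      then show "(\<lambda>s. (u + s) mod f) ` {s \<in> ?V. gcd s f \<in> D} \<subseteq> nbrs u"
        by (auto simp: nbrs_def poly_residue_ring_def)
      show "(\<lambda>w. (w - u) mod f) ` nbrs u \<subseteq> {s \<in> ?V. gcd s f \<in> D}"
        by (auto simp: nbrs_def poly_residue_ring_def gcd_sym[of u] gcd_mod_left[OF f])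
    qed (auto simp: nbrs_def poly_residue_ring_def mod_simps)
    then have "(\<Sum>w\<in>nbrs u. \<chi> (g * w)) = (\<Sum>s | s \<in> ?V \<and> gcd s f \<in> D. \<chi> (g * ((u + s) mod f)))"
      by (rule sum.reindex_bij_betw[symmetric])
    also have "\<dots> = (\<Sum>s | s \<in> ?V \<and> gcd s f \<in> D. \<chi> (g * s) * \<chi> (g * u))"
      unfolding primitive_character_mod[OF \<chi>] by (simp add: distrib_left add mult.commute)
    finally show ?thesis by (simp add: ev_def sum_distrib_right)
  qed
  have nonzero: "\<chi> u \<noteq> 0" for u
    using add[of u "- u"] primitive_character_0[OF \<chi>] by auto
  have "spectrum (adjacency_matrix vs (gcd_graph f D)) = ev ` ?V"
  proof (intro equalityI subsetI)
    fix k assume "k \<in> ev ` ?V"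
    then obtain g where g: "k = ev g" "g \<in> ?V" by blast
    have "0 \<in> ?V" by (simp add: poly_residue_ring_def)
    then show "k \<in> spectrum (adjacency_matrix vs (gcd_graph f D))"
      unfolding spectrum_adjacency_matrix_iff[OF vs(1)]
      by (intro exI[of _ "\<lambda>w. \<chi> (g * w)"]) (auto simp: V parcs[unfolded V] eigen g nonzero)
  next
    fix k assume "k \<in> spectrum (adjacency_matrix vs (gcd_graph f D))"
    then obtain x u where u: "u \<in> ?V" "x u \<noteq> 0"
      and x: "\<And>u. u \<in> ?V \<Longrightarrow> (\<Sum>w\<in>nbrs u. x w) = k * x u"
      unfolding spectrum_adjacency_matrix_iff[OF vs(1)] by (auto simp: V parcs[unfolded V])
    define X where "X g = (\<Sum>w\<in>?V. \<chi> (g * w) * x w)" for g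
    have X: "k * X g = ev g * X g" for g
    proof -
      have "k * X g = (\<Sum>u\<in>?V. \<Sum>w\<in>nbrs u. \<chi> (g * u) * x w)"
        unfolding X_def sum_distrib_left[symmetric] using x
        by (simp add: sum_distrib_left mult.left_commute)
      also have "\<dots> = (\<Sum>w\<in>?V. \<Sum>u\<in>nbrs w. \<chi> (g * u) * x w)"
        unfolding nbrs_def using fin
        by (subst sum.swap_restrict) (auto simp: gcd_sym)
      also have "\<dots> = ev g * X g"
        unfolding sum_distrib_right[symmetric] eigen
        by (simp add: X_def sum_distrib_left mult.assoc)
      finally show ?thesis .
    qed
    have shift: "\<chi> (- (g * u)) * \<chi> (g * w) = \<chi> ((w - u) * g)" for g w
      using add[of "- (g * u)" "g * w"] by (simp add: algebra_simps)
    \<comment> \<open>Fourier inversion at the point \<open>u\<close>: were \<open>X\<close> to vanish identically, so would \<open>x u\<close>.\<close>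
    have "(\<Sum>g\<in>?V. \<chi> (- (g * u)) * X g) = (\<Sum>g\<in>?V. \<Sum>w\<in>?V. \<chi> ((w - u) * g) * x w)"
      by (simp add: X_def sum_distrib_left shift flip: mult.assoc)
    also have "\<dots> = (\<Sum>w\<in>?V. (\<Sum>g\<in>?V. \<chi> ((w - u) * g)) * x w)"
      by (subst sum.swap) (simp add: sum_distrib_right)
    also have "\<dots> = (\<Sum>w\<in>?V. if w = u then of_nat (card ?V) * x w else 0)"
    proof (intro sum.cong refl)
      fix w assume "w \<in> ?V"
      then have "f dvd w - u \<longleftrightarrow> w = u"
        using u by (auto simp: poly_residue_ring_def mod_eq_dvd_iff[symmetric])
      then show "(\<Sum>g\<in>?V. \<chi> ((w - u) * g)) * x w = (if w = u then of_nat (card ?V) * x w else 0)"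
        by (simp add: primitive_character_orthogonality[OF \<chi>])
    qed
    also have "\<dots> = of_nat (card ?V) * x u" using u fin by simp
    also have "\<dots> \<noteq> 0" using u fin by auto
    finally have "(\<Sum>g\<in>?V. \<chi> (- (g * u)) * X g) \<noteq> 0" .
    then obtain g where "g \<in> ?V" "\<chi> (- (g * u)) * X g \<noteq> 0" by (rule sum.not_neutral_contains_not_neutral)
    then have "g \<in> ?V" "X g \<noteq> 0" by auto
    with X[of g] show "k \<in> ev ` ?V" by auto
  qed
  then show ?thesis by (simp add: ev_def[abs_def])
qed

theorem theorem6p19:
  fixes f :: "'a::{finite, field_gcd} poly"
    and D :: "'a poly set"
    and \<zeta> :: complex
    and \<psi> :: "'a poly \<Rightarrow> 'a poly \<Rightarrow> 'a"
    and vs :: "'a poly list"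
  assumes "monic f"
    and "\<forall>d \<in> D. monic d \<and> d dvd f"
    and "f \<notin> D"
    and "primitive_root_of_unity CHAR('a) \<zeta>"
    and "\<forall>d \<in> D. nondegenerate_functional (f div d) (\<psi> (f div d))"
    and "distinct vs" and "set vs = pverts (gcd_graph f D)"
  shows "spectrum (adjacency_matrix vs (gcd_graph f D)) =
           (\<lambda>g. \<Sum>d \<in> D. ramanujan_sum \<zeta> (\<psi> (f div d)) g (f div d)) ` carrier (poly_residue_ring f)
       \<and> spectrum (adjacency_matrix vs (gcd_graph f D)) \<subseteq> \<int>"
proof -
  let ?V = "carrier (poly_residue_ring f)"
  have f0: "f \<noteq> 0" using assms(1) by auto
  have finV: "finite ?V" by (rule finite_carrier_poly_residue_ring[OF f0])
  have D: "monic d" "d * (f div d) = f" "d \<noteq> 0" "monic (f div d)" "f div d \<noteq> 0" if "d \<in> D" for d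
  proof -
    show d: "monic d" "d * (f div d) = f" using assms(2) that by auto
    then show "d \<noteq> 0" by auto
    show "monic (f div d)" using d assms(1) by (metis lead_coeff_mult mult_1)
    then show "f div d \<noteq> 0" by auto
  qed
  have finD: "finite D"
  proof (rule finite_subset[OF _ finV], rule subsetI)
    fix d assume d: "d \<in> D"
    have "f div d \<noteq> 1" using D(2)[OF d] assms(3) d by auto
    then have "degree (f div d) > 0" using D(4)[OF d] monic_degree_0 by blast
    moreover have "degree f = degree d + degree (f div d)"
      using D[OF d] f0 by (metis degree_mult_eq mult_zero_right)
    ultimately show "d \<in> ?V" by (simp add: poly_residue_ring_def mod_poly_less)
  qed
  \<comment> \<open>A functional modulo \<open>f\<close> itself: the family \<open>\<psi>\<close> only supplies functionals modulo the \<open>f div d\<close>.\<close>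
  obtain \<psi>\<^sub>f where "nondegenerate_functional f \<psi>\<^sub>f"
    using nondegenerate_functional_top_coeff[OF assms(1)] by blast
  then obtain \<chi> where \<chi>: "primitive_character f \<chi>"
    using primitive_character_functional[OF assms(4)] by blast
  have summand: "(\<Sum>s | s \<in> ?V \<and> gcd s f = d. \<chi> (g * s)) = ramanujan_sum \<zeta> (\<psi> (f div d)) g (f div d)
      \<and> ramanujan_sum \<zeta> (\<psi> (f div d)) g (f div d) \<in> \<int>" if d: "d \<in> D" for d g
  proof -
    obtain c where c: "c \<in> \<int>"
      "\<And>\<chi>. primitive_character (f div d) \<chi> \<Longrightarrow> character_ramanujan_sum \<chi> g (f div d) = c"
      using character_ramanujan_sum_Ints_independent[OF D(4)[OF d]] by blast
    have "primitive_character (f div d) (\<lambda>u. \<chi> (d * u))"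
      using \<chi> D[OF d] by (intro primitive_character_mult) auto
    then have "(\<Sum>s | s \<in> ?V \<and> gcd s f = d. \<chi> (g * s)) = c"
      using sum_gcd_class[OF D(1)[OF d] D(2)[OF d, symmetric]] c(2) by simp
    moreover have "ramanujan_sum \<zeta> (\<psi> (f div d)) g (f div d) = c"
      unfolding ramanujan_sum_eq_character[OF D(5)[OF d]] using assms(4,5) d
      by (intro c(2) primitive_character_functional) auto
    ultimately show ?thesis using c(1) by simp
  qed
  have "(\<Sum>s | s \<in> ?V \<and> gcd s f \<in> D. \<chi> (g * s)) =
      (\<Sum>d\<in>D. ramanujan_sum \<zeta> (\<psi> (f div d)) g (f div d))" for g
  proof -
    have "(\<Sum>s | s \<in> ?V \<and> gcd s f \<in> D. \<chi> (g * s)) =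
        (\<Sum>d\<in>D. \<Sum>s | s \<in> {s. s \<in> ?V \<and> gcd s f \<in> D} \<and> gcd s f = d. \<chi> (g * s))"
      using finV finD by (intro sum.group[symmetric]) auto
    also have "\<dots> = (\<Sum>d\<in>D. \<Sum>s | s \<in> ?V \<and> gcd s f = d. \<chi> (g * s))"
      by (intro sum.cong) auto
    finally show ?thesis using summand by simp
  qed
  then have "spectrum (adjacency_matrix vs (gcd_graph f D)) =
      (\<lambda>g. \<Sum>d\<in>D. ramanujan_sum \<zeta> (\<psi> (f div d)) g (f div d)) ` ?V"
    using spectrum_gcd_graph_character[OF f0 \<chi> assms(6,7)] by simp
  then show ?thesis using summand by (auto intro!: Ints_sum)
qed

end
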